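(* Let $n$ be a positive integer. The Drazin inverse of $I_n-P_n$ is $$\left(I_n-P_n\right)^{D}=\frac{1}{2n}\sum_{i=0}^{n-1}(n-2i-1)\,P_n^{i}.$$
   Context: Matrices are complex, with indices running over $\{0,1,\dots,n-1\}$. $P_n$ is the $n\times n$ permutation matrix with $(P_n)_{i,j}=1$ if $j\equiv i+1\pmod n$ and $0$ otherwise; $P_n^0=I_n$. The index of a square matrix $A$ is the smallest non-negative integer $k$ such that $A^k$ and $A^{k+1}$ have the same column space. If $A$ has index $k$, its Drazin inverse $A^D$ is the unique matrix with $AA^D=A^DA$, $A^{k+1}A^D=A^k$ and $A^DAA^D=A^D$. *)

theory Defs
  imports "Jordan_Normal_Form.VS_Connect" "HOL-Number_Theory.Cong"
begin

definition cyclic_perm_mat :: "nat \<Rightarrow> complex mat" where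
  "cyclic_perm_mat n = mat n n (\<lambda>(i, j). if [j = i + 1] (mod n) then 1 else 0)"

definition mat_index :: "complex mat \<Rightarrow> nat" where
  "mat_index A = (LEAST k. vec_space.col_space (dim_row A) (A ^\<^sub>m k) =
                           vec_space.col_space (dim_row A) (A ^\<^sub>m (k + 1)))"

definition is_drazin_inverse :: "complex mat \<Rightarrow> complex mat \<Rightarrow> bool" where
  "is_drazin_inverse A X \<longleftrightarrow>
     square_mat A \<and> X \<in> carrier_mat (dim_row A) (dim_row A) \<and>
     A * X = X * A \<and>
     A ^\<^sub>m (mat_index A + 1) * X = A ^\<^sub>m (mat_index A) \<and>
     X * A * X = X"

text \<open>The description operator is only meaningful where existence and uniqueness are
  known; a claim about the value of \<open>drazin_inverse A\<close> should therefore be accompanied by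
  \<open>is_drazin_inverse A\<close> of that value.\<close>

definition drazin_inverse :: "complex mat \<Rightarrow> complex mat" where
  "drazin_inverse A = (THE X. is_drazin_inverse A X)"

end

theory Submission
  imports Defs
begin

text \<open>Write \<open>A = I - P\<close>, \<open>J = \<Sum>i<n. P^i\<close> and \<open>S = \<Sum>i<n. (n - 2 i - 1) P^i\<close>. Telescoping and
  \<open>P^n = I\<close> give \<open>A J = 0\<close> and \<open>A S = 2 n I - 2 J\<close>, while \<open>P J = J\<close> and the vanishing of the
  coefficient sum of \<open>S\<close> give \<open>S J = 0\<close>. Hence \<open>X = S / (2 n)\<close> commutes with \<open>A\<close> and satisfies
  \<open>A A X = A\<close> and \<open>X A X = X\<close>. Such an \<open>X\<close> is the Drazin inverse:
  \<open>A\<close> and \<open>A A\<close> have the same column space, and if already \<open>I\<close> and \<open>A\<close> do, then the equations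
  give \<open>A X = I\<close>.\<close>

section \<open>Uniqueness of the Drazin inverse\<close>

lemma pow_mat_commute:
  fixes A B :: "'a::semiring_1 mat"
  assumes "A \<in> carrier_mat n n" "B \<in> carrier_mat n n" "A * B = B * A"
  shows "A ^\<^sub>m k * B = B * A ^\<^sub>m k"
proof (induction k)
  case 0
  then show ?case using assms by simp
next
  case (Suc k)
  have Ak: "A ^\<^sub>m k \<in> carrier_mat n n"
    using assms by simp
  have "A ^\<^sub>m Suc k * B = A ^\<^sub>m k * (B * A)"
    using assms Ak by (simp add: assoc_mult_mat[of _ n n _ n _ n])
  also have "\<dots> = (A ^\<^sub>m k * B) * A"
    using assms Ak by (simp add: assoc_mult_mat[of _ n n _ n _ n])
  also have "\<dots> = B * A ^\<^sub>m Suc k"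
    using assms Ak by (simp add: Suc assoc_mult_mat[of _ n n _ n _ n])
  finally show ?case .
qed

text \<open>Because \<open>A\<close> and \<open>X\<close> commute, the innermost factors regroup to
  \<open>X * A * X = X\<close>, so each induction step strips one power from both sides. The lemma
  exposes a factor \<open>A ^\<^sub>m k\<close> inside \<open>X\<close> for any
  \<open>k\<close>.\<close>

lemma outer_inverse_pow_mat:
  fixes A X :: "'a::semiring_1 mat"
  assumes A: "A \<in> carrier_mat n n" and X: "X \<in> carrier_mat n n"
    and comm: "A * X = X * A" and outer: "X * A * X = X"
  shows "X ^\<^sub>m k * A ^\<^sub>m k * X = X"
proof (induction k)
  case 0
  then show ?case using A X by simp
next
  case (Suc k)
  note assoc = assoc_mult_mat[of _ n n _ n _ n]
  have Ak: "A ^\<^sub>m k \<in> carrier_mat n n" and Xk: "X ^\<^sub>m k \<in> carrier_mat n n"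
    using A X by simp_all
  have "X ^\<^sub>m Suc k * A ^\<^sub>m Suc k * X = X ^\<^sub>m k * ((X * A ^\<^sub>m k) * (A * X))"
    using A X Ak Xk by (simp add: assoc mult_carrier_mat[of _ n n _ n])
  also have "X * A ^\<^sub>m k = A ^\<^sub>m k * X"
    using pow_mat_commute[OF A X comm] by simp
  also have "X ^\<^sub>m k * ((A ^\<^sub>m k * X) * (A * X)) = X ^\<^sub>m k * A ^\<^sub>m k * (X * A * X)"
    using A X Ak Xk by (simp add: assoc)
  finally show ?case
    by (simp add: outer Suc)
qed

text \<open>Both inverses equal \<open>X * A * Y\<close>. Expanding \<open>X\<close> through its
  \<open>k\<close>-th powers exposes \<open>A ^\<^sub>m k\<close>, which absorbs
  \<open>A * Y\<close> on its right; expanding \<open>Y\<close> in the same way exposes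
  \<open>A ^\<^sub>m k\<close>, which absorbs \<open>X * A\<close> on its left.\<close>

lemma is_drazin_inverse_unique:
  assumes "is_drazin_inverse A X" "is_drazin_inverse A Y"
  shows "X = Y"
proof -
  define n k where "n = dim_row A" and "k = mat_index A"
  note defs = is_drazin_inverse_def n_def[symmetric] k_def[symmetric]
  note assoc = assoc_mult_mat[of _ n n _ n _ n]
  have A: "A \<in> carrier_mat n n" and X: "X \<in> carrier_mat n n" and Y: "Y \<in> carrier_mat n n"
    using assms by (auto simp: is_drazin_inverse_def n_def)
  have cX: "A * X = X * A" and oX: "X * A * X = X" and kX: "A ^\<^sub>m k * A * X = A ^\<^sub>m k"
    and cY: "A * Y = Y * A" and oY: "Y * A * Y = Y" and kY: "A ^\<^sub>m k * A * Y = A ^\<^sub>m k"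
    using assms by (simp_all add: defs)
  have Ak: "A ^\<^sub>m k \<in> carrier_mat n n" and Xk: "X ^\<^sub>m k \<in> carrier_mat n n"
    and Yk: "Y ^\<^sub>m k \<in> carrier_mat n n"
    using A X Y by simp_all
  note carr = A X Y Ak Xk Yk
  have cXk: "A ^\<^sub>m k * X = X * A ^\<^sub>m k" and cYk: "A ^\<^sub>m k * Y = Y * A ^\<^sub>m k"
    using pow_mat_commute A X Y cX cY by blast+
  have cYYk: "Y ^\<^sub>m k * A ^\<^sub>m k = A ^\<^sub>m k * Y ^\<^sub>m k"
    using pow_mat_commute[OF Y Ak cYk[symmetric]] .
  have "X = X ^\<^sub>m k * (A ^\<^sub>m k * X)"
    using outer_inverse_pow_mat[OF A X cX oX, of k] carr by (simp add: assoc)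
  also have "\<dots> = X ^\<^sub>m k * (X * (A ^\<^sub>m k * A * Y))"
    by (simp add: cXk kY)
  also have "\<dots> = X ^\<^sub>m k * (X * A ^\<^sub>m k) * (A * Y)"
    using carr by (simp add: assoc)
  also have "\<dots> = X * (A * Y)"
    using outer_inverse_pow_mat[OF A X cX oX, of k] carr by (simp add: assoc cXk[symmetric])
  finally have 1: "X = X * (A * Y)" .
  \<comment> \<open>The mirror image of \<open>kX\<close>: commutation moves \<open>X * A\<close> to
    the left of the power, where it is needed for \<open>Y\<close>.\<close>
  have kX': "A ^\<^sub>m k = X * A * A ^\<^sub>m k"
  proof -
    have "A ^\<^sub>m k = A ^\<^sub>m k * (X * A)"
      using kX carr by (simp add: assoc cX)
    also have "\<dots> = X * (A ^\<^sub>m k * A)"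
      using carr by (simp add: cXk assoc flip: assoc[of "A ^\<^sub>m k" X A])
    also have "A ^\<^sub>m k * A = A * A ^\<^sub>m k"
      using pow_mat_commute[OF A A] by simp
    finally show ?thesis
      using carr by (simp add: assoc)
  qed
  have Y': "Y = A ^\<^sub>m k * (Y ^\<^sub>m k * Y)"
    using outer_inverse_pow_mat[OF A Y cY oY, of k] carr by (simp add: cYYk assoc)
  also have "\<dots> = X * A * A ^\<^sub>m k * (Y ^\<^sub>m k * Y)"
    using kX' by simp
  also have "\<dots> = X * (A * (A ^\<^sub>m k * (Y ^\<^sub>m k * Y)))"
    using carr by (simp add: assoc mult_carrier_mat[of _ n n _ n])
  finally have "Y = X * (A * Y)"
    using Y' by simp
  with 1 show ?thesis by simp
qed

lemma drazin_inverse_eqI: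
  assumes "is_drazin_inverse A X"
  shows "drazin_inverse A = X"
  unfolding drazin_inverse_def
  using assms is_drazin_inverse_unique by (intro the_equality) auto

section \<open>Column spaces, the index, and group inverses\<close>

lemma col_space_mult_subset:
  fixes A B :: "'a::field mat"
  assumes A: "A \<in> carrier_mat n m" and B: "B \<in> carrier_mat m l"
  shows "vec_space.col_space n (A * B) \<subseteq> vec_space.col_space n A"
proof -
  interpret vec_space "TYPE('a)" n .
  show ?thesis
    using A B by (auto simp: col_space_eq[OF A] col_space_eq[OF mult_carrier_mat[OF A B]]
        assoc_mult_mat_vec[OF A B] intro: mult_mat_vec_carrier)
qed

text \<open>Every unit vector has a preimage under \<open>A\<close>. Preimages chosen as columns
  form a right inverse, and a right inverse of a square matrix over a field is also a left
  inverse.\<close>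

lemma left_inverse_if_col_space_eq_one:
  fixes A :: "'a::field mat"
  assumes A: "A \<in> carrier_mat n n"
    and eq: "vec_space.col_space n (1\<^sub>m n :: 'a mat) = vec_space.col_space n A"
  obtains B where "B \<in> carrier_mat n n" "B * A = 1\<^sub>m n"
proof -
  interpret vec_space "TYPE('a)" n .
  have "\<exists>x\<in>carrier_vec n. A *\<^sub>v x = unit_vec n j" if "j < n" for j
  proof -
    have "unit_vec n j \<in> col_space (1\<^sub>m n :: 'a mat)"
      by (auto simp: col_space_eq[OF one_carrier_mat] intro!: bexI[of _ "unit_vec n j"])
    then show ?thesis
      using A unfolding eq by (auto simp: col_space_eq[OF A])
  qed
  then obtain x where x: "\<And>j. j < n \<Longrightarrow> x j \<in> carrier_vec n \<and> A *\<^sub>v x j = unit_vec n j"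
    by metis
  define B where "B = mat n n (\<lambda>(i, j). x j $ i)"
  have B: "B \<in> carrier_mat n n"
    by (simp add: B_def)
  have "A * B = 1\<^sub>m n"
  proof (rule eq_matI)
    fix i j assume "i < dim_row (1\<^sub>m n :: 'a mat)" "j < dim_col (1\<^sub>m n :: 'a mat)"
    then have ij: "i < n" "j < n" by simp_all
    have "col B j = x j"
      using ij x[of j] by (auto simp: B_def)
    then have "(A * B) $$ (i, j) = (A *\<^sub>v x j) $ i"
      using ij A B by simp
    then show "(A * B) $$ (i, j) = 1\<^sub>m n $$ (i, j)"
      using ij x[of j] by simp
  qed (use A B in auto)
  then show thesis
    using that[OF B] mat_mult_left_right_inverse[OF A B] by blast
qed

lemma group_inverse_is_drazin_inverse:
  assumes A: "A \<in> carrier_mat n n" and X: "X \<in> carrier_mat n n"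
    and comm: "A * X = X * A" and AAX: "A * A * X = A" and XAX: "X * A * X = X"
  shows "is_drazin_inverse A X"
proof -
  note assoc = assoc_mult_mat[of _ n n _ n _ n]
  let ?P = "\<lambda>k. vec_space.col_space (dim_row A) (A ^\<^sub>m k) =
                vec_space.col_space (dim_row A) (A ^\<^sub>m (k + 1))"
  have "vec_space.col_space n A = vec_space.col_space n (A * A)"
  proof
    \<comment> \<open>The equation \<open>A * A * X = A\<close> writes \<open>A\<close> as a right
      multiple of \<open>A * A\<close>.\<close>
    show "vec_space.col_space n A \<subseteq> vec_space.col_space n (A * A)"
      using col_space_mult_subset[of "A * A" n n X n] A X AAX by simp
  qed (use col_space_mult_subset[OF A A] in simp)
  then have "?P 1"
    using A by simp
  then have "mat_index A \<le> 1" and P: "?P (mat_index A)"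
    unfolding mat_index_def by (rule Least_le, rule LeastI)
  then consider "mat_index A = 0" | "mat_index A = 1"
    by linarith
  then have "A ^\<^sub>m (mat_index A + 1) * X = A ^\<^sub>m (mat_index A)"
  proof cases
    \<comment> \<open>At index 0 the required equation reads \<open>A * X = 1\<^sub>m n\<close>; it
      follows by cancelling one \<open>A\<close> on the left of
      \<open>A * A * X = A\<close>.\<close>
    case 1
    with P A have "vec_space.col_space n (1\<^sub>m n :: complex mat) = vec_space.col_space n A"
      by simp
    from left_inverse_if_col_space_eq_one[OF A this]
    obtain B where B: "B \<in> carrier_mat n n" "B * A = 1\<^sub>m n" .
    have "A * X = B * A * A * X"
      using A B X by simp
    also have "\<dots> = B * (A * A * X)"
      using A B(1) X by (simp add: assoc)
    finally have "A * X = 1\<^sub>m n"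
      by (simp add: AAX B)
    with 1 A show ?thesis by simp
  next
    case 2
    with A AAX show ?thesis by simp
  qed
  with A X comm XAX show ?thesis
    by (auto simp: is_drazin_inverse_def)
qed

section \<open>Finite sums of square matrices\<close>

text \<open>The matrix type does not fix dimensions, so it has no single zero matrix; the sum is
  formed in the additive group of \<open>n\<close> by \<open>n\<close> matrices instead.\<close>

abbreviation (input) mat_sum :: "nat \<Rightarrow> (nat \<Rightarrow> 'a::comm_ring_1 mat) \<Rightarrow> nat \<Rightarrow> 'a mat" where
  "mat_sum n f m \<equiv> (\<Oplus>\<^bsub>module_mat TYPE('a) n n\<^esub> i\<in>{0..<m}. f i)"

lemma mat_sum_closed:
  fixes f :: "nat \<Rightarrow> 'a::comm_ring_1 mat"
  assumes "\<And>i. f i \<in> carrier_mat n n"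
  shows "mat_sum n f m \<in> carrier_mat n n"
proof -
  interpret abelian_group "module_mat TYPE('a) n n"
    by (rule abelian_group_mat)
  show ?thesis
    using finsum_closed[of f "{0..<m}"] assms by (simp add: module_mat_simps)
qed

lemma mat_sum_empty:
  fixes f :: "'b \<Rightarrow> 'a::comm_ring_1 mat"
  shows "(\<Oplus>\<^bsub>module_mat TYPE('a) n n\<^esub> i\<in>{}. f i) = 0\<^sub>m n n"
proof -
  interpret abelian_group "module_mat TYPE('a) n n"
    by (rule abelian_group_mat)
  show ?thesis by (simp add: module_mat_simps)
qed

lemma mat_sum_Suc:
  fixes f :: "nat \<Rightarrow> 'a::comm_ring_1 mat"
  assumes "\<And>i. f i \<in> carrier_mat n n"
  shows "mat_sum n f (Suc m) = f m + mat_sum n f m"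
proof -
  interpret abelian_group "module_mat TYPE('a) n n"
    by (rule abelian_group_mat)
  show ?thesis
    using finsum_insert[of "{0..<m}" m f] assms
    by (simp add: module_mat_simps atLeast0_lessThan_Suc)
qed

lemma mult_mat_sum_commute:
  fixes f :: "nat \<Rightarrow> 'a::comm_ring_1 mat"
  assumes f: "\<And>i. f i \<in> carrier_mat n n" and B: "B \<in> carrier_mat n n"
    and comm: "\<And>i. B * f i = f i * B"
  shows "B * mat_sum n f m = mat_sum n f m * B"
proof (induction m)
  case 0
  then show ?case using B by (simp add: mat_sum_empty)
next
  case (Suc m)
  show ?case
    unfolding mat_sum_Suc[of f n, OF f]
    using mult_add_distrib_mat[OF B f mat_sum_closed[of f n m, OF f], of m]
      add_mult_distrib_mat[OF f mat_sum_closed[of f n m, OF f] B, of m] comm Suc by simp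
qed

section \<open>Telescoping identities for partial sums of powers\<close>

locale square_matrix =
  fixes n :: nat and P :: "'a::comm_ring_1 mat"
  assumes P: "P \<in> carrier_mat n n"
begin

abbreviation (input) power_sum :: "nat \<Rightarrow> 'a mat" where
  "power_sum \<equiv> mat_sum n (\<lambda>i. P ^\<^sub>m i)"

abbreviation (input) weighted_power_sum :: "nat \<Rightarrow> 'a mat" where
  "weighted_power_sum \<equiv> mat_sum n (\<lambda>i. (of_nat n - 2 * of_nat i - 1) \<cdot>\<^sub>m (P ^\<^sub>m i))"

lemma Pi: "P ^\<^sub>m i \<in> carrier_mat n n"
  using P by simp

lemma cPi: "c \<cdot>\<^sub>m (P ^\<^sub>m i) \<in> carrier_mat n n"
  using P by simp

lemmas power_sum_closed = mat_sum_closed[of "\<lambda>i. P ^\<^sub>m i", OF Pi]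
lemmas weighted_power_sum_closed =
  mat_sum_closed[of "\<lambda>i. (of_nat n - 2 * of_nat i - 1) \<cdot>\<^sub>m (P ^\<^sub>m i)", OF cPi]
lemmas power_sum_Suc = mat_sum_Suc[of "\<lambda>i. P ^\<^sub>m i", OF Pi]
lemmas weighted_power_sum_Suc =
  mat_sum_Suc[of "\<lambda>i. (of_nat n - 2 * of_nat i - 1) \<cdot>\<^sub>m (P ^\<^sub>m i)", OF cPi]

lemma mult_pow: "P * P ^\<^sub>m i = P ^\<^sub>m Suc i"
  using pow_mat_commute[OF P P refl, of i] by simp

lemma one_minus_mult: "B \<in> carrier_mat n n \<Longrightarrow> (1\<^sub>m n - P) * B = B - P * B"
  using P by (simp add: minus_mult_distrib_mat[of _ n n])

lemma one_minus_mult_pow: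
  "(1\<^sub>m n - P) * (c \<cdot>\<^sub>m (P ^\<^sub>m i)) = c \<cdot>\<^sub>m (P ^\<^sub>m i) - c \<cdot>\<^sub>m (P ^\<^sub>m Suc i)"
  using P by (simp add: one_minus_mult[OF cPi] mult_smult_distrib[OF P Pi] mult_pow del: pow_mat.simps)

lemma one_minus_commute_pow: "(1\<^sub>m n - P) * P ^\<^sub>m i = P ^\<^sub>m i * (1\<^sub>m n - P)"
  using P by (simp add: one_minus_mult[OF Pi] mult_minus_distrib_mat[OF Pi one_carrier_mat P]
      mult_pow right_mult_one_mat[OF Pi])

lemma one_minus_mult_power_sum:
  "(1\<^sub>m n - P) * power_sum m = 1\<^sub>m n - P ^\<^sub>m m"
proof (induction m)
  case 0
  then show ?case using P by (auto intro!: eq_matI simp: mat_sum_empty)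
next
  case (Suc m)
  have "(1\<^sub>m n - P) * power_sum (Suc m) = (P ^\<^sub>m m - P ^\<^sub>m Suc m) + (1\<^sub>m n - P ^\<^sub>m m)"
    unfolding power_sum_Suc Suc[symmetric]
      mult_add_distrib_mat[OF minus_carrier_mat[OF P] Pi power_sum_closed]
    by (simp only: one_minus_mult[OF Pi] mult_pow)
  then show ?case
    using carrier_matD[OF Pi[of m]] carrier_matD[OF Pi[of "Suc m"]] carrier_matD[OF P]
    by (auto intro!: eq_matI simp del: pow_mat.simps)
qed

text \<open>Summation by parts: consecutive weights differ by -2, so each inner power keeps the
  coefficient -2. Extending \<open>2 \<cdot>\<^sub>m power_sum m\<close> to the term at 0 raises the
  boundary weight \<open>n - 1\<close> to \<open>n + 1\<close>. For \<open>m = n\<close> and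
  \<open>P ^\<^sub>m n = 1\<^sub>m n\<close> the two boundary terms combine to \<open>2 * n\<close>
  times the identity.\<close>

lemma one_minus_mult_weighted_power_sum:
  "(1\<^sub>m n - P) * weighted_power_sum m =
     (of_nat n + 1) \<cdot>\<^sub>m 1\<^sub>m n - 2 \<cdot>\<^sub>m power_sum m - (of_nat n - 2 * of_nat m + 1) \<cdot>\<^sub>m (P ^\<^sub>m m)"
proof (induction m)
  case 0
  then show ?case using P by (auto intro!: eq_matI simp: mat_sum_empty)
next
  case (Suc m)
  have "(1\<^sub>m n - P) * weighted_power_sum (Suc m) =
      ((of_nat n - 2 * of_nat m - 1) \<cdot>\<^sub>m (P ^\<^sub>m m) - (of_nat n - 2 * of_nat m - 1) \<cdot>\<^sub>m (P ^\<^sub>m Suc m)) +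
      ((of_nat n + 1) \<cdot>\<^sub>m 1\<^sub>m n - 2 \<cdot>\<^sub>m power_sum m - (of_nat n - 2 * of_nat m + 1) \<cdot>\<^sub>m (P ^\<^sub>m m))"
    unfolding weighted_power_sum_Suc Suc[symmetric] one_minus_mult_pow[symmetric]
    using P by (subst mult_add_distrib_mat[OF _ cPi weighted_power_sum_closed]) auto
  \<comment> \<open>With abstract matrices the identity is plain ring algebra in each entry; it is
    used with \<open>a = n - 2 * m\<close> and \<open>b = n + 1\<close>.\<close>
  moreover have "(a - 1) \<cdot>\<^sub>m Q - (a - 1) \<cdot>\<^sub>m R + (b \<cdot>\<^sub>m 1\<^sub>m n - 2 \<cdot>\<^sub>m T - (a + 1) \<cdot>\<^sub>m Q) =
      b \<cdot>\<^sub>m 1\<^sub>m n - 2 \<cdot>\<^sub>m (Q + T) - (a - 1) \<cdot>\<^sub>m R"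
    if "Q \<in> carrier_mat n n" "R \<in> carrier_mat n n" "T \<in> carrier_mat n n" for a b :: 'a and Q R T
    using that by (intro eq_matI) (auto simp: algebra_simps)
  note this[OF Pi[of m] Pi[of "Suc m"] power_sum_closed[of m], of "of_nat n - 2 * of_nat m" "of_nat n + 1"]
  moreover have "of_nat n - 2 * of_nat m - 1 = (of_nat n - 2 * of_nat (Suc m) + 1 :: 'a)"
    by simp
  ultimately show ?case
    unfolding power_sum_Suc by metis
qed

lemma pow_mult_fixed:
  assumes "J \<in> carrier_mat n n" "P * J = J"
  shows "P ^\<^sub>m i * J = J"
  using assms P by (induction i) (simp_all add: assoc_mult_mat[of _ n n _ n _ n])

text \<open>Every power of \<open>P\<close> acts on \<open>J\<close> as the identity, so the sum
  acts as the total of its weights. That total is \<open>m * (n - m)\<close>, which vanishes at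
  \<open>m = n\<close>.\<close>

lemma weighted_power_sum_mult_fixed:
  assumes J: "J \<in> carrier_mat n n" and PJ: "P * J = J"
  shows "weighted_power_sum m * J = (of_nat m * (of_nat n - of_nat m)) \<cdot>\<^sub>m J"
proof (induction m)
  case 0
  then show ?case using J by (auto intro!: eq_matI simp: mat_sum_empty)
next
  case (Suc m)
  have "weighted_power_sum (Suc m) * J =
      (of_nat n - 2 * of_nat m - 1) \<cdot>\<^sub>m J + (of_nat m * (of_nat n - of_nat m)) \<cdot>\<^sub>m J"
    unfolding weighted_power_sum_Suc
    by (simp add: add_mult_distrib_mat[OF cPi weighted_power_sum_closed J] Suc
        mult_smult_assoc_mat[OF Pi J] pow_mult_fixed[OF J PJ])
  then show ?case
    using J by (auto intro!: eq_matI simp: algebra_simps)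
qed

end

section \<open>The Drazin inverse of \<open>1\<^sub>m n - P\<close> when
  \<open>P ^\<^sub>m n = 1\<^sub>m n\<close>\<close>

lemma is_drazin_inverse_one_minus_cyclic:
  fixes P :: "complex mat"
  assumes P: "P \<in> carrier_mat n n" and Pn: "P ^\<^sub>m n = 1\<^sub>m n" and n: "n > 0"
  shows "is_drazin_inverse (1\<^sub>m n - P)
           ((1 / (2 * of_nat n)) \<cdot>\<^sub>m mat_sum n (\<lambda>i. (of_nat n - 2 * of_nat i - 1) \<cdot>\<^sub>m (P ^\<^sub>m i)) n)"
proof -
  interpret square_matrix n P
    by unfold_locales (rule P)
  note assoc = assoc_mult_mat[of _ n n _ n _ n]
  define A J S X where "A = 1\<^sub>m n - P" and "J = power_sum n" and "S = weighted_power_sum n"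
    and "X = (1 / (2 * of_nat n)) \<cdot>\<^sub>m S"
  have A: "A \<in> carrier_mat n n" and J: "J \<in> carrier_mat n n" and S: "S \<in> carrier_mat n n"
    using P power_sum_closed weighted_power_sum_closed by (auto simp: A_def J_def S_def)
  then have X: "X \<in> carrier_mat n n" by (simp add: X_def)
  have AJ: "A * J = 0\<^sub>m n n"
    using one_minus_mult_power_sum[of n] by (auto simp: A_def J_def Pn)
  then have "J - P * J = 0\<^sub>m n n"
    using one_minus_mult[OF J] by (simp add: A_def)
  then have PJ: "P * J = J"
    using P J by (auto simp: mat_eq_iff)
  have AS: "A * S = (2 * of_nat n) \<cdot>\<^sub>m 1\<^sub>m n - 2 \<cdot>\<^sub>m J"
    using one_minus_mult_weighted_power_sum[of n] J
    by (auto intro!: eq_matI simp: A_def J_def[symmetric] S_def Pn)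
  \<comment> \<open>The factor \<open>1 / (2 * n)\<close> normalises the identity term of
    \<open>A * S\<close>. Since \<open>A\<close> and \<open>X\<close> both annihilate
    \<open>J\<close>, multiplying either of them by \<open>A * X\<close> on the right leaves it
    unchanged; this yields \<open>AAX\<close> and \<open>XAX\<close>.\<close>
  have AX: "A * X = 1\<^sub>m n - (1 / of_nat n) \<cdot>\<^sub>m J"
    using J n by (auto intro!: eq_matI simp: X_def mult_smult_distrib[OF A S] AS field_simps)
  have "S * J = 0\<^sub>m n n"
    using weighted_power_sum_mult_fixed[OF J PJ, of n] J
    by (auto simp: S_def)
  then have XJ: "X * J = 0\<^sub>m n n"
    by (simp add: X_def mult_smult_assoc_mat[OF S J])
  have "A * P ^\<^sub>m i = P ^\<^sub>m i * A" for i
    unfolding A_def by (rule one_minus_commute_pow)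
  then have "A * S = S * A"
    unfolding S_def
    by (intro mult_mat_sum_commute[OF cPi A])
      (simp add: mult_smult_distrib[OF A Pi] mult_smult_assoc_mat[OF Pi A])
  then have comm: "A * X = X * A"
    by (simp add: X_def mult_smult_distrib[OF A S] mult_smult_assoc_mat[OF S A])
  have "A * A * X = A * (1\<^sub>m n - (1 / of_nat n) \<cdot>\<^sub>m J)"
    using A X by (simp add: assoc AX)
  also have "\<dots> = A"
    using A by (auto simp: mult_minus_distrib_mat[OF A one_carrier_mat smult_carrier_mat[OF J]]
        mult_smult_distrib[OF A J] AJ)
  finally have AAX: "A * A * X = A" .
  have "X * A * X = X * (1\<^sub>m n - (1 / of_nat n) \<cdot>\<^sub>m J)"
    using A X by (simp add: assoc AX)
  also have "\<dots> = X"
    using X by (auto simp: mult_minus_distrib_mat[OF X one_carrier_mat smult_carrier_mat[OF J]]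
        mult_smult_distrib[OF X J] XJ)
  finally have XAX: "X * A * X = X" .
  show ?thesis
    using group_inverse_is_drazin_inverse[OF A X comm AAX XAX] by (simp add: A_def X_def S_def)
qed

section \<open>Powers of the cyclic permutation matrix\<close>

lemma cyclic_perm_mat_carrier [simp]: "cyclic_perm_mat n \<in> carrier_mat n n"
  by (simp add: cyclic_perm_mat_def)

lemma cyclic_perm_mat_pow:
  "cyclic_perm_mat n ^\<^sub>m k = mat n n (\<lambda>(i, j). if [j = i + k] (mod n) then 1 else 0)"
proof (induction k)
  case 0
  have "[j = i] (mod n) \<longleftrightarrow> i = j" if "i < n" "j < n" for i j
    using that by (auto simp: cong_def)
  then show ?case
    by (auto intro!: eq_matI simp: cyclic_perm_mat_def)
next
  case (Suc k)
  have "(\<Sum>l = 0..<n. (if [l = i + k] (mod n) then 1 else 0) * (if [j = l + 1] (mod n) then 1 else 0)) =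
      (if [j = i + Suc k] (mod n) then 1 else 0 :: complex)" if "i < n" "j < n" for i j
  proof -
    \<comment> \<open>Within the index range the congruence selects a single \<open>l\<close>, so
      the sum defining the matrix product collapses to one term.\<close>
    have "[l = i + k] (mod n) \<longleftrightarrow> l = (i + k) mod n" if "l < n" for l
      using that by (simp add: cong_def)
    then have "(\<Sum>l = 0..<n. (if [l = i + k] (mod n) then 1 else 0) *
          (if [j = l + 1] (mod n) then 1 else 0)) =
        (\<Sum>l = 0..<n. if l = (i + k) mod n then if [j = l + 1] (mod n) then 1 else 0 else 0 :: complex)"
      by (intro sum.cong) auto
    also have "\<dots> = (if [j = (i + k) mod n + 1] (mod n) then 1 else 0)"
      using that by simp
    also have "[j = (i + k) mod n + 1] (mod n) \<longleftrightarrow> [j = i + Suc k] (mod n)"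
      by (simp add: cong_def mod_Suc_eq)
    finally show ?thesis .
  qed
  then have "mat n n (\<lambda>(i, j). if [j = i + k] (mod n) then 1 else 0) * cyclic_perm_mat n =
      mat n n (\<lambda>(i, j). if [j = i + Suc k] (mod n) then 1 else 0)"
    by (intro eq_matI) (simp_all add: scalar_prod_def cyclic_perm_mat_def)
  then show ?case
    by (simp add: Suc)
qed

lemma cyclic_perm_mat_pow_self: "cyclic_perm_mat n ^\<^sub>m n = 1\<^sub>m n"
  by (rule eq_matI) (auto simp: cyclic_perm_mat_pow cong_def)

theorem theorem6p3:
  fixes n :: nat
  assumes "n > 0"
  shows "is_drazin_inverse (1\<^sub>m n - cyclic_perm_mat n)
           (drazin_inverse (1\<^sub>m n - cyclic_perm_mat n)) \<and>
         drazin_inverse (1\<^sub>m n - cyclic_perm_mat n) =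
           (1 / (2 * of_nat n)) \<cdot>\<^sub>m
             (\<Oplus>\<^bsub>module_mat TYPE(complex) n n\<^esub> i\<in>{0..<n}.
                (of_nat n - 2 * of_nat i - 1) \<cdot>\<^sub>m (cyclic_perm_mat n ^\<^sub>m i))"
proof -
  note drazin = is_drazin_inverse_one_minus_cyclic
    [OF cyclic_perm_mat_carrier cyclic_perm_mat_pow_self assms]
  show ?thesis
    \<comment> \<open>Replacing the description by its value turns the first conjunct into
      \<open>drazin\<close> and the second into a reflexive equation.\<close>
    using drazin unfolding drazin_inverse_eqI[OF drazin] by blast
qed

end
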